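(* Let $p$ be a prime and let $G$ be a non-abelian group of order $p^n$ with $3\leq n\leq 5$. Then $\mathrm{Aut}_c(G)=\mathrm{Aut}_z(G)$ if and only if $\gamma_2(G)=Z(G)$ and $Z(G)$ is cyclic.
   Context: $Z(G)$ is the center and $\gamma_2(G)$ the commutator subgroup of $G$. $\mathrm{Aut}_c(G)$ is the group of all class preserving automorphisms of $G$, i.e. automorphisms $\alpha$ such that $\alpha(x)$ is conjugate to $x$ in $G$ for every $x\in G$. $\mathrm{Aut}_z(G)$ is the group of all central automorphisms of $G$, i.e. automorphisms $\phi$ such that $g^{-1}\phi(g)\in Z(G)$ for every $g\in G$. *)

theory Defs
  imports "HOL-Algebra.Algebra"
begin

definition center :: "('a, 'b) monoid_scheme \<Rightarrow> 'a set" where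
  "center G = {z \<in> carrier G. \<forall>g \<in> carrier G. z \<otimes>\<^bsub>G\<^esub> g = g \<otimes>\<^bsub>G\<^esub> z}"

(* Groups of automorphisms are given by their underlying sets, as subgroups are in HOL-Algebra:
   both sets below lie in the carrier of AutoGroup G, whose elements are the automorphisms that
   are extensional on the carrier of G.  Equality of two such sets is thus equality of
   subgroups of Aut(G). *)

definition class_preserving_auto :: "('a, 'b) monoid_scheme \<Rightarrow> ('a \<Rightarrow> 'a) set" where
  "class_preserving_auto G =
     {\<alpha> \<in> auto G. \<forall>x \<in> carrier G. \<exists>g \<in> carrier G. \<alpha> x = inv\<^bsub>G\<^esub> g \<otimes>\<^bsub>G\<^esub> x \<otimes>\<^bsub>G\<^esub> g}"

definition central_auto :: "('a, 'b) monoid_scheme \<Rightarrow> ('a \<Rightarrow> 'a) set" where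
  "central_auto G =
     {\<phi> \<in> auto G. \<forall>g \<in> carrier G. inv\<^bsub>G\<^esub> g \<otimes>\<^bsub>G\<^esub> \<phi> g \<in> center G}"

end

theory Submission
  imports Defs
begin

text \<open>
  In a group of class two \<open>g \<mapsto> [x,g]\<close> is a homomorphism into the center, and a central automorphism is
  \<open>g \<mapsto> g \<otimes> f g\<close> for a homomorphism \<open>f\<close> into the center; it preserves classes iff \<open>f x \<in> [x,G]\<close> for
  all \<open>x\<close>.

  If \<open>\<gamma>\<^sub>2(G) = Z(G)\<close> is cyclic, then \<open>f x\<close> and \<open>[x,G]\<close> are compared through their orders.

  Conversely, inner automorphisms are central, so \<open>G\<close> has class two.  Extending characters of the finite
  abelian groups \<open>G/M\<close>, where \<open>M\<close> is \<open>Z(G)\<close> or \<open>\<gamma>\<^sub>2(G)\<close>, gives enough homomorphisms \<open>f\<close> to conclude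
  that \<open>\<gamma>\<^sub>2(G) = Z(G)\<close> and that \<open>[x,G] = Z(G)\<close> whenever \<open>x\<close> has maximal order modulo the center.
  Counting then gives \<open>|Z(G)|\<^sup>2 < |G|\<close>.  So for a non-cyclic center and \<open>n \<le> 5\<close> the center is elementary
  abelian of order \<open>p\<^sup>2\<close> and \<open>G/Z(G)\<close> has order \<open>p\<^sup>3\<close>; composing the commutator with a projection of the
  center onto a group of order \<open>p\<close> gives a nondegenerate alternating form on a space of dimension
  three, which is impossible.
\<close>

section \<open>The center and commutators\<close>

text \<open>The bracketing exhibits the commutator as the factor by which conjugation by
  \<open>g\<close> moves \<open>x\<close>, which is what class preservation is about.\<close>

definition commutator :: "('a, 'b) monoid_scheme \<Rightarrow> 'a \<Rightarrow> 'a \<Rightarrow> 'a" where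
  "commutator G x g = inv\<^bsub>G\<^esub> x \<otimes>\<^bsub>G\<^esub> (inv\<^bsub>G\<^esub> g \<otimes>\<^bsub>G\<^esub> x \<otimes>\<^bsub>G\<^esub> g)"

context group
begin

lemma center_subgroup: "subgroup (center G) G"
proof (rule subgroupI)
  show "center G \<subseteq> carrier G" "center G \<noteq> {}"
    by (auto simp: center_def intro!: exI[of _ \<one>])
next
  fix a assume "a \<in> center G"
  then have a: "a \<in> carrier G" and comm: "\<And>g. g \<in> carrier G \<Longrightarrow> a \<otimes> g = g \<otimes> a"
    by (auto simp: center_def)
  have "inv a \<otimes> g = g \<otimes> inv a" if g: "g \<in> carrier G" for g
  proof -
    have "inv a \<otimes> g = inv a \<otimes> (g \<otimes> a) \<otimes> inv a"
      using a g by (simp add: m_assoc)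
    also have "\<dots> = g \<otimes> inv a"
      using a g by (simp add: comm[symmetric] m_assoc[symmetric])
    finally show ?thesis .
  qed
  then show "inv a \<in> center G"
    using a by (simp add: center_def)
next
  fix a b assume "a \<in> center G" "b \<in> center G"
  then have ab: "a \<in> carrier G" "b \<in> carrier G"
    and comm: "\<And>g. g \<in> carrier G \<Longrightarrow> a \<otimes> g = g \<otimes> a" "\<And>g. g \<in> carrier G \<Longrightarrow> b \<otimes> g = g \<otimes> b"
    by (auto simp: center_def)
  have "a \<otimes> b \<otimes> g = g \<otimes> (a \<otimes> b)" if g: "g \<in> carrier G" for g
  proof -
    have "a \<otimes> b \<otimes> g = a \<otimes> g \<otimes> b"
      using ab g by (simp add: m_assoc comm(2))
    also have "\<dots> = g \<otimes> (a \<otimes> b)"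
      using ab g by (simp add: comm(1) m_assoc)
    finally show ?thesis .
  qed
  then show "a \<otimes> b \<in> center G"
    using ab by (simp add: center_def)
qed

lemma center_carrier: "z \<in> center G \<Longrightarrow> z \<in> carrier G"
  and center_comm: "z \<in> center G \<Longrightarrow> g \<in> carrier G \<Longrightarrow> z \<otimes> g = g \<otimes> z"
  by (auto simp: center_def)

lemma commutator_closed [simp, intro]:
  "x \<in> carrier G \<Longrightarrow> g \<in> carrier G \<Longrightarrow> commutator G x g \<in> carrier G"
  by (simp add: commutator_def)

text \<open>Cancelling \<open>g \<otimes> x\<close> leaves a single possible \<open>c\<close>, so
  commutators can be computed by moving factors past each other instead of expanding
  inverses.\<close>

lemma commutator_eqI:
  assumes "x \<in> carrier G" "g \<in> carrier G" "c \<in> carrier G" "x \<otimes> g = g \<otimes> x \<otimes> c"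
  shows "commutator G x g = c"
proof -
  have "commutator G x g = inv x \<otimes> (inv g \<otimes> (x \<otimes> g))"
    using assms by (simp add: commutator_def m_assoc)
  also have "\<dots> = (inv x \<otimes> ((inv g \<otimes> g) \<otimes> x)) \<otimes> c"
    using assms(1-3) unfolding assms(4) by (simp only: m_assoc m_closed inv_closed)
  finally show ?thesis
    using assms(1-3) by simp
qed

lemma mult_commutator:
  assumes "x \<in> carrier G" "g \<in> carrier G"
  shows "x \<otimes> g = g \<otimes> x \<otimes> commutator G x g"
proof -
  have "g \<otimes> x \<otimes> commutator G x g = g \<otimes> ((x \<otimes> inv x) \<otimes> inv g) \<otimes> x \<otimes> g"
    using assms unfolding commutator_def by (simp only: m_assoc m_closed inv_closed)
  then show ?thesis
    using assms by simp
qed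

lemma commutator_in_derived:
  assumes "x \<in> carrier G" "g \<in> carrier G"
  shows "commutator G x g \<in> derived G (carrier G)"
proof -
  \<comment> \<open>The generators of \<open>derived\<close> have the form
    \<open>a \<otimes> b \<otimes> inv a \<otimes> inv b\<close>, so the inverses of
    \<open>x\<close> and \<open>g\<close> serve as witnesses.\<close>
  have "commutator G x g = inv x \<otimes> inv g \<otimes> inv (inv x) \<otimes> inv (inv g)"
    using assms by (simp add: commutator_def m_assoc)
  then show ?thesis
    unfolding derived_def
    by (intro generate.incl UN_I[of "inv x"] UN_I[of "inv g"]) (use assms in auto)
qed

lemma derived_subsetI:
  assumes "subgroup H G"
    and "\<And>x g. x \<in> carrier G \<Longrightarrow> g \<in> carrier G \<Longrightarrow> commutator G x g \<in> H"
  shows "derived G (carrier G) \<subseteq> H"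
  unfolding derived_def
proof (rule generate_subgroup_incl[OF _ assms(1)], safe)
  fix a b assume ab: "a \<in> carrier G" "b \<in> carrier G"
  then have "a \<otimes> b \<otimes> inv a \<otimes> inv b = commutator G (inv a) (inv b)"
    by (simp add: commutator_def m_assoc)
  then show "a \<otimes> b \<otimes> inv a \<otimes> inv b \<in> H"
    using assms(2)[of "inv a" "inv b"] ab by simp
qed

lemma commutator_central_left:
  "z \<in> center G \<Longrightarrow> g \<in> carrier G \<Longrightarrow> commutator G z g = \<one>"
  by (rule commutator_eqI) (auto simp: center_carrier center_comm)

lemma commutator_central_right:
  "z \<in> center G \<Longrightarrow> g \<in> carrier G \<Longrightarrow> commutator G g z = \<one>"
  by (rule commutator_eqI) (auto simp: center_carrier center_comm)

lemma commutator_self: "g \<in> carrier G \<Longrightarrow> commutator G g g = \<one>"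
  by (rule commutator_eqI) auto

lemma centerI:
  assumes "x \<in> carrier G" "\<And>g. g \<in> carrier G \<Longrightarrow> commutator G x g = \<one>"
  shows "x \<in> center G"
  using assms mult_commutator[of x] by (auto simp: center_def)

text \<open>Here \<open>m\<close> is the order of \<open>a\<close> modulo \<open>S\<close>: the
  least positive exponent leading into \<open>S\<close>. The remainder of any other such exponent on
  division by \<open>m\<close> would contradict minimality unless it is zero.\<close>

lemma least_exponent:
  assumes fin: "finite (carrier G)" and S: "subgroup S G" and a: "a \<in> carrier G"
  obtains m :: nat where "0 < m" "\<And>j::int. a [^] j \<in> S \<longleftrightarrow> int m dvd j"
proof -
  interpret S: subgroup S G by fact
  define m where "m = (LEAST m::nat. 0 < m \<and> a [^] m \<in> S)"
  have "0 < ord a \<and> a [^] ord a \<in> S"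
    using ord_ge_1[OF fin a] a by simp
  then have m: "0 < m" "a [^] m \<in> S"
    unfolding m_def by (metis (mono_tags, lifting) LeastI)+
  have least: "m \<le> k" if "0 < k" "a [^] k \<in> S" for k :: nat
    unfolding m_def using that by (intro Least_le) auto
  have mult: "a [^] (int m * k) \<in> S" for k
    using m(2) a subgroup_int_pow_closed[OF S, of "a [^] m" k]
    by (simp add: int_pow_pow[symmetric] int_pow_int)
  have "int m dvd j" if j: "a [^] j \<in> S" for j :: int
  proof -
    have "a [^] (j mod int m) = a [^] j \<otimes> inv (a [^] (int m * (j div int m)))"
      using a by (simp add: minus_mult_div_eq_mod [symmetric] int_pow_diff)
    then have "a [^] (j mod int m) \<in> S"
      using j mult by simp
    then have "a [^] nat (j mod int m) \<in> S"
      using m(1) by (metis int_nat_eq int_pow_int mod_int_pos_iff pos_mod_sign of_nat_0_less_iff)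
    then have "\<not> 0 < nat (j mod int m)"
      using least m(1) by (metis linorder_not_le nat_less_iff of_nat_0_less_iff pos_mod_bound pos_mod_sign)
    then show ?thesis
      using m(1) by (metis dvd_eq_mod_eq_0 nat_0_iff neq0_conv pos_mod_sign of_nat_0_less_iff order_antisym)
  qed
  then show thesis
    using that[OF m(1)] mult by (metis dvdE)
qed

end

section \<open>Extending characters of finite abelian groups\<close>

context comm_group
begin

text \<open>A homomorphism from \<open>B\<close> to the integers modulo \<open>N\<close>, given by
  integer representatives. Its values can then serve directly as exponents of an element whose order
  divides \<open>N\<close>.\<close>

definition additive_mod :: "nat \<Rightarrow> 'a set \<Rightarrow> ('a \<Rightarrow> int) \<Rightarrow> bool" where
  "additive_mod N B \<chi> \<longleftrightarrow>
     (\<forall>x\<in>B. \<forall>y\<in>B. int N dvd \<chi> (x \<otimes> y) - (\<chi> x + \<chi> y))"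

lemma additive_mod_one:
  assumes "additive_mod N B \<chi>" "\<one> \<in> B"
  shows "int N dvd \<chi> \<one>"
proof -
  have "int N dvd \<chi> (\<one> \<otimes> \<one>) - (\<chi> \<one> + \<chi> \<one>)"
    using assms unfolding additive_mod_def by blast
  then show ?thesis
    by (simp add: dvd_diff_commute algebra_simps)
qed

lemma additive_mod_pow:
  assumes \<chi>: "additive_mod N B \<chi>" and B: "subgroup B G" and b: "b \<in> B"
  shows "int N dvd \<chi> (b [^] (j::int)) - j * \<chi> b"
proof -
  interpret B: subgroup B G by fact
  have bc: "b \<in> carrier G" using b by simp
  have step: "int N dvd \<chi> (b [^] (j + 1)) - (\<chi> (b [^] j) + \<chi> b)" for j :: int
    using \<chi> b bc subgroup_int_pow_closed[OF B b, of j] unfolding additive_mod_def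
    by (metis int_pow_1 int_pow_mult)
  show ?thesis
  proof (induction j rule: int_induct[of _ 0])
    case base
    then show ?case using additive_mod_one[OF \<chi>] by simp
  next
    case (step1 i)
    have "\<chi> (b [^] (i + 1)) - (i + 1) * \<chi> b =
        (\<chi> (b [^] (i + 1)) - (\<chi> (b [^] i) + \<chi> b)) + (\<chi> (b [^] i) - i * \<chi> b)"
      by (simp add: algebra_simps)
    then show ?case using step[of i] step1 by (metis dvd_add)
  next
    case (step2 i)
    have "\<chi> (b [^] (i - 1)) - (i - 1) * \<chi> b =
        (\<chi> (b [^] i) - i * \<chi> b) - (\<chi> (b [^] (i - 1 + 1)) - (\<chi> (b [^] (i - 1)) + \<chi> b))"
      by (simp add: algebra_simps)
    then show ?case using step[of "i - 1"] step2 by (metis dvd_diff)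
  qed
qed

text \<open>The new subgroup is generated by \<open>B\<close> and \<open>a\<close>, and
  \<open>b \<otimes> a [^] k\<close> receives the value \<open>\<chi> b + k * r\<close>. Overlaps
  arise only from powers of \<open>a [^] m\<close>, and there the condition on \<open>r\<close> says
  that both candidate values agree modulo \<open>N\<close>.\<close>

lemma additive_mod_extend_step:
  assumes B: "subgroup B G" and \<chi>: "additive_mod N B \<chi>" and a: "a \<in> carrier G"
    and m: "\<And>j::int. a [^] j \<in> B \<longleftrightarrow> int m dvd j"
    and r: "int N dvd int m * r - \<chi> (a [^] m)"
  obtains B' \<chi>' where "subgroup B' G" "B \<subseteq> B'" "a \<in> B'" "additive_mod N B' \<chi>'"
    "\<forall>b\<in>B. int N dvd \<chi>' b - \<chi> b" "int N dvd \<chi>' a - r"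
proof -
  interpret B: subgroup B G by fact
  have wd: "int N dvd (\<chi> b + k * r) - (\<chi> b' + k' * r)"
    if b: "b \<in> B" "b' \<in> B" and eq: "b \<otimes> a [^] k = b' \<otimes> a [^] k'" for b b' and k k' :: int
  proof -
    have "b' = b \<otimes> a [^] (k - k')"
      using eq b a by (simp add: int_pow_diff inv_solve_right m_assoc[symmetric])
    moreover have "a [^] (k - k') \<in> B"
    proof -
      have "a [^] (k - k') = inv b \<otimes> b'"
        using b a \<open>b' = _\<close> by (simp add: m_assoc[symmetric])
      then show ?thesis using b by simp
    qed
    moreover from this obtain j where j: "k - k' = int m * j"
      using m by blast
    ultimately have 1: "int N dvd \<chi> b' - (\<chi> b + \<chi> (a [^] (int m * j)))"
      using \<chi> b unfolding additive_mod_def by metis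
    have am: "a [^] m \<in> B"
      using m[of "int m"] by (simp add: int_pow_int)
    have 2: "int N dvd \<chi> (a [^] (int m * j)) - j * \<chi> (a [^] m)"
      using additive_mod_pow[OF \<chi> B am, of j] a by (simp add: int_pow_pow int_pow_int[symmetric])
    have "(\<chi> b + k * r) - (\<chi> b' + k' * r) =
        j * (int m * r - \<chi> (a [^] m)) - (\<chi> b' - (\<chi> b + \<chi> (a [^] (int m * j))))
        - (\<chi> (a [^] (int m * j)) - j * \<chi> (a [^] m))"
      using arg_cong[OF j, of "\<lambda>t. t * r"] by (simp add: algebra_simps)
    then show ?thesis
      using 1 2 r by (metis dvd_diff dvd_mult)
  qed
  define B' where "B' = {b \<otimes> a [^] (k::int) | b k. b \<in> B}"
  \<comment> \<open>An arbitrary representation is chosen for each element; by \<open>wd\<close> the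
    resulting value depends on the choice only up to multiples of \<open>N\<close>.\<close>
  define rep where "rep x = (SOME q. fst q \<in> B \<and> x = fst q \<otimes> a [^] (snd q :: int))" for x
  define \<chi>' where "\<chi>' x = \<chi> (fst (rep x)) + snd (rep x) * r" for x
  have memE: "\<exists>b k. x = b \<otimes> a [^] (k::int) \<and> b \<in> B" if "x \<in> B'" for x
    using that by (simp only: B'_def mem_Collect_eq)
  have rep: "fst (rep x) \<in> B" "x = fst (rep x) \<otimes> a [^] snd (rep x)" if x: "x \<in> B'" for x
  proof -
    obtain b k where "b \<in> B" "x = b \<otimes> a [^] (k::int)"
      using memE[OF x] by blast
    then have "\<exists>q. fst q \<in> B \<and> x = fst q \<otimes> a [^] (snd q :: int)"
      by (intro exI[of _ "(b, k)"]) simp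
    from someI_ex[OF this] show "fst (rep x) \<in> B" "x = fst (rep x) \<otimes> a [^] snd (rep x)"
      unfolding rep_def by auto
  qed
  have memI: "b \<otimes> a [^] k \<in> B'" if "b \<in> B" for b and k :: int
    unfolding B'_def mem_Collect_eq using that by (intro exI conjI) auto
  have val: "int N dvd \<chi>' (b \<otimes> a [^] k) - (\<chi> b + k * r)" if "b \<in> B" for b and k :: int
    unfolding \<chi>'_def by (rule wd[OF rep(1)[OF memI[OF that]] that rep(2)[OF memI[OF that], symmetric]])
  have prod: "(b \<otimes> a [^] k) \<otimes> (b' \<otimes> a [^] k') = (b \<otimes> b') \<otimes> a [^] (k + k')"
    if "b \<in> B" "b' \<in> B" for b b' and k k' :: int
    using that a by (simp add: int_pow_mult m_ac)
  have "subgroup B' G"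
  proof (rule subgroupI)
    show "B' \<subseteq> carrier G" "B' \<noteq> {}"
      using a memI[OF B.one_closed] memE by (auto dest!: memE)
  next
    fix x assume "x \<in> B'"
    then obtain b k where bk: "b \<in> B" "x = b \<otimes> a [^] (k::int)"
      using memE by blast
    then have "inv x = inv b \<otimes> a [^] (- k)"
      using a by (simp add: inv_mult int_pow_neg)
    then show "inv x \<in> B'"
      using memI[of "inv b" "- k"] bk by simp
  next
    fix x y assume "x \<in> B'" "y \<in> B'"
    then obtain b k b' k' where "b \<in> B" "x = b \<otimes> a [^] (k::int)" "b' \<in> B" "y = b' \<otimes> a [^] (k'::int)"
      using memE[of x] memE[of y] by blast
    then show "x \<otimes> y \<in> B'"
      using prod memI by simp
  qed
  moreover have "B \<subseteq> B'"
    using memI[of _ 0] by (auto simp: B.mem_carrier)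
  moreover have "a \<in> B'"
    using memI[OF B.one_closed, of 1] a by simp
  moreover have "additive_mod N B' \<chi>'"
    unfolding additive_mod_def
  proof (intro ballI)
    fix x y assume "x \<in> B'" "y \<in> B'"
    then obtain b k b' k' where bk: "b \<in> B" "x = b \<otimes> a [^] (k::int)" "b' \<in> B" "y = b' \<otimes> a [^] (k'::int)"
      using memE[of x] memE[of y] by blast
    have 1: "int N dvd \<chi> (b \<otimes> b') - (\<chi> b + \<chi> b')"
      using \<chi> bk unfolding additive_mod_def by blast
    have 2: "int N dvd \<chi>' (x \<otimes> y) - (\<chi> (b \<otimes> b') + (k + k') * r)"
      using val[of "b \<otimes> b'" "k + k'"] prod[of b b' k k'] bk by simp
    have 3: "int N dvd \<chi>' x - (\<chi> b + k * r)" "int N dvd \<chi>' y - (\<chi> b' + k' * r)"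
      using val bk by auto
    have "\<chi>' (x \<otimes> y) - (\<chi>' x + \<chi>' y) =
        (\<chi>' (x \<otimes> y) - (\<chi> (b \<otimes> b') + (k + k') * r)) + (\<chi> (b \<otimes> b') - (\<chi> b + \<chi> b'))
        - (\<chi>' x - (\<chi> b + k * r)) - (\<chi>' y - (\<chi> b' + k' * r))"
      by (simp add: algebra_simps)
    then show "int N dvd \<chi>' (x \<otimes> y) - (\<chi>' x + \<chi>' y)"
      using 1 2 3 by (metis dvd_add dvd_diff)
  qed
  moreover have "\<forall>b\<in>B. int N dvd \<chi>' b - \<chi> b"
    using val[of _ 0] by (auto simp: B.mem_carrier)
  moreover have "int N dvd \<chi>' a - r"
  proof -
    have "int N dvd (\<chi>' a - (\<chi> \<one> + r)) + \<chi> \<one>"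
      using val[OF B.one_closed, of 1] a additive_mod_one[OF \<chi> B.one_closed] by (intro dvd_add) auto
    then show ?thesis by simp
  qed
  ultimately show thesis
    by (rule that)
qed

text \<open>Elements outside the current subgroup are adjoined one at a time, by induction on the
  number of elements still missing.\<close>

lemma additive_mod_extend:
  assumes fin: "finite (carrier G)" and N: "0 < N" "\<And>a. a \<in> carrier G \<Longrightarrow> a [^] N = \<one>"
    and "subgroup B G" "additive_mod N B \<chi>"
  shows "\<exists>\<chi>'. additive_mod N (carrier G) \<chi>' \<and> (\<forall>b\<in>B. int N dvd \<chi>' b - \<chi> b)"
  using assms(4,5)
proof (induction "card (carrier G) - card B" arbitrary: B \<chi> rule: less_induct)
  case less
  interpret B: subgroup B G by fact
  show ?case
  proof (cases "carrier G \<subseteq> B")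
    case True
    then show ?thesis using less.prems B.subset by (intro exI[of _ \<chi>]) auto
  next
    case False
    then obtain a where a: "a \<in> carrier G" "a \<notin> B" by blast
    obtain m where m: "0 < m" "\<And>j::int. a [^] j \<in> B \<longleftrightarrow> int m dvd j"
      using least_exponent[OF fin less.prems(1) a(1)] by blast
    have "a [^] int N \<in> B"
      using N a by (simp add: int_pow_int)
    then obtain q where q: "N = m * q"
      using m by (auto elim: dvdE)
    then have q0: "0 < q" using N by simp
    have am: "a [^] m \<in> B"
      using m(2)[of "int m"] by (simp add: int_pow_int)
    \<comment> \<open>Since \<open>(a [^] m) [^] q = a [^] N = \<one>\<close>, the number
      \<open>q * \<chi> (a [^] m)\<close> vanishes modulo \<open>N = m * q\<close>. Hence
      \<open>m\<close> divides \<open>\<chi> (a [^] m)\<close>, and the quotient is the value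
      \<open>r\<close> that the extension step asks for.\<close>
    have "int N dvd \<chi> \<one> - int q * \<chi> (a [^] m)"
      using additive_mod_pow[OF less.prems(2,1) am, of "int q"] N(2) a q
      by (simp add: int_pow_int nat_pow_pow)
    then have "int N dvd int q * \<chi> (a [^] m)"
      using dvd_diff[OF additive_mod_one[OF less.prems(2) B.one_closed]] by fastforce
    then have "int m dvd \<chi> (a [^] m)"
      using q q0 by (simp add: mult.commute)
    then obtain r where "\<chi> (a [^] m) = int m * r" ..
    then have r: "int N dvd int m * r - \<chi> (a [^] m)" by simp
    obtain B' \<chi>' where B': "subgroup B' G" "B \<subseteq> B'" "a \<in> B'" "additive_mod N B' \<chi>'"
      "\<forall>b\<in>B. int N dvd \<chi>' b - \<chi> b"
      "int N dvd \<chi>' a - r"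
      by (rule additive_mod_extend_step[OF less.prems a(1) m(2) r])
    interpret B': subgroup B' G by fact
    have "card B < card B'"
      using B' a finite_subset[OF B'.subset fin] by (intro psubset_card_mono) auto
    moreover have "card B' \<le> card (carrier G)"
      using fin B'.subset by (rule card_mono)
    ultimately have "card (carrier G) - card B' < card (carrier G) - card B" by simp
    from less.hyps[OF this B'(1,4)] obtain \<chi>'' where
      \<chi>'': "additive_mod N (carrier G) \<chi>''" "\<forall>b\<in>B'. int N dvd \<chi>'' b - \<chi>' b" by blast
    have "int N dvd \<chi>'' b - \<chi> b" if "b \<in> B" for b
    proof -
      have "int N dvd (\<chi>'' b - \<chi>' b) + (\<chi>' b - \<chi> b)"
        using that \<chi>''(2) B' by (intro dvd_add) auto
      then show ?thesis by simp
    qed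
    then show ?thesis using \<chi>'' by blast
  qed
qed

text \<open>Extend the zero character of the trivial subgroup to one containing \<open>x\<close>,
  and then to the whole group. The value \<open>N div ord x\<close> has order \<open>ord x\<close>
  modulo \<open>N\<close>, so the character is faithful on the powers of \<open>x\<close>.\<close>

lemma additive_mod_exists:
  assumes fin: "finite (carrier G)" and N: "0 < N" "\<And>a. a \<in> carrier G \<Longrightarrow> a [^] N = \<one>"
    and x: "x \<in> carrier G"
  obtains \<chi> where "additive_mod N (carrier G) \<chi>" "int N dvd \<chi> x - int (N div ord x)"
proof -
  have 0: "additive_mod N {\<one>} (\<lambda>_. 0)"
    by (simp add: additive_mod_def)
  have o: "x [^] j \<in> {\<one>} \<longleftrightarrow> int (ord x) dvd j" for j :: int
    using x by (simp add: int_pow_eq_id)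
  have "ord x dvd N"
    using N x by (simp add: pow_eq_id[symmetric])
  then have r: "int N dvd int (ord x) * int (N div ord x) - 0"
    by (simp flip: of_nat_mult)
  obtain B' \<chi>' where B': "subgroup B' G" "x \<in> B'" "additive_mod N B' \<chi>'"
      "int N dvd \<chi>' x - int (N div ord x)"
    by (rule additive_mod_extend_step[OF triv_subgroup 0 x o r])
  from additive_mod_extend[OF fin N B'(1,3)] obtain \<chi> where
    \<chi>: "additive_mod N (carrier G) \<chi>" "\<forall>b\<in>B'. int N dvd \<chi> b - \<chi>' b" by blast
  have "int N dvd (\<chi> x - \<chi>' x) + (\<chi>' x - int (N div ord x))"
    using \<chi> B' by (intro dvd_add) auto
  then show thesis using that \<chi>(1) by simp
qed

end

section \<open>Homomorphisms into the center and central automorphisms\<close>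

context group
begin

lemma comm_group_FactGroup:
  assumes M: "subgroup M G"
    and c: "\<And>x g. x \<in> carrier G \<Longrightarrow> g \<in> carrier G \<Longrightarrow> commutator G x g \<in> M"
  shows "M \<lhd> G" "comm_group (G Mod M)"
proof -
  interpret M: subgroup M G by fact
  show n: "M \<lhd> G"
  proof (rule normal_invI[OF M])
    fix x h assume x: "x \<in> carrier G" and h: "h \<in> M"
    then have "x \<otimes> h \<otimes> inv x = h \<otimes> commutator G h (inv x)"
      by (simp add: commutator_def m_assoc[symmetric])
    then show "x \<otimes> h \<otimes> inv x \<in> M"
      using c[of h "inv x"] x h by simp
  qed
  interpret M: normal M G by fact
  show "comm_group (G Mod M)"
  proof (rule group.group_comm_groupI[OF M.factorgroup_is_group])
    fix U V assume "U \<in> carrier (G Mod M)" "V \<in> carrier (G Mod M)"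
    then obtain x y where xy: "x \<in> carrier G" "y \<in> carrier G" "U = M #> x" "V = M #> y"
      by (auto simp: carrier_FactGroup)
    have "commutator G (inv x) (inv y) \<otimes> (y \<otimes> x) = x \<otimes> y \<otimes> (inv x \<otimes> ((inv y \<otimes> y) \<otimes> x))"
      using xy unfolding commutator_def by (simp only: m_assoc m_closed inv_closed inv_inv)
    then have "x \<otimes> y = commutator G (inv x) (inv y) \<otimes> (y \<otimes> x)"
      using xy by simp
    then have "x \<otimes> y \<in> M #> (y \<otimes> x)"
      using c[of "inv x" "inv y"] xy unfolding r_coset_def by auto
    then have "M #> (x \<otimes> y) = M #> (y \<otimes> x)"
      using xy M by (metis m_closed repr_independence)
    then show "U \<otimes>\<^bsub>G Mod M\<^esub> V = V \<otimes>\<^bsub>G Mod M\<^esub> U"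
      using xy by (simp add: M.rcos_sum)
  qed
qed

text \<open>The map sends \<open>g\<close> to its coset, applies a character \<open>\<chi>\<close>
  of the abelian quotient by \<open>M\<close>, and raises \<open>u\<close> to the resulting
  exponent. The value at \<open>x\<close> reflects that the coset of \<open>x\<close> has order
  \<open>k\<close>.\<close>

lemma hom_to_center:
  assumes fin: "finite (carrier G)" and M: "subgroup M G"
    and c: "\<And>x g. x \<in> carrier G \<Longrightarrow> g \<in> carrier G \<Longrightarrow> commutator G x g \<in> M"
    and N: "0 < N" "\<And>g. g \<in> carrier G \<Longrightarrow> g [^] N \<in> M"
    and x: "x \<in> carrier G" and k: "\<And>j::int. x [^] j \<in> M \<longleftrightarrow> int k dvd j"
    and u: "u \<in> center G" "u [^] N = \<one>"
  obtains f where "f \<in> hom G G" "f ` carrier G \<subseteq> center G" "\<forall>g\<in>M. f g = \<one>"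
    "f x = u [^] (N div k)"
proof -
  interpret M: normal M G using comm_group_FactGroup(1)[OF M c] .
  interpret Q: comm_group "G Mod M" using comm_group_FactGroup(2)[OF M c] .
  have finQ: "finite (carrier (G Mod M))"
    using fin by (simp add: carrier_FactGroup)
  have powQ: "U [^]\<^bsub>G Mod M\<^esub> N = \<one>\<^bsub>G Mod M\<^esub>" if "U \<in> carrier (G Mod M)" for U
    using that N by (auto simp: carrier_FactGroup M.FactGroup_pow coset_join2[OF _ M])
  have xQ: "M #> x \<in> carrier (G Mod M)"
    using x by (simp add: carrier_FactGroup)
  have ordQ: "Q.ord (M #> x) = k"
    unfolding Q.ord_unique[OF xQ]
  proof
    fix n :: nat
    have "(M #> x) [^]\<^bsub>G Mod M\<^esub> n = \<one>\<^bsub>G Mod M\<^esub> \<longleftrightarrow> M #> (x [^] n) = M"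
      using x by (simp add: M.FactGroup_pow)
    also have "\<dots> \<longleftrightarrow> x [^] n \<in> M"
      using x coset_join1[OF _ _ M, of "x [^] n"] coset_join2[OF _ M, of "x [^] n"] M.subset by auto
    also have "\<dots> \<longleftrightarrow> k dvd n"
      using k[of "int n"] by (simp add: int_pow_int)
    finally show "(M #> x) [^]\<^bsub>G Mod M\<^esub> n = \<one>\<^bsub>G Mod M\<^esub> \<longleftrightarrow> k dvd n" .
  qed
  obtain \<chi> where \<chi>: "Q.additive_mod N (carrier (G Mod M)) \<chi>"
      "int N dvd \<chi> (M #> x) - int (N div k)"
    using Q.additive_mod_exists[OF finQ N(1) powQ xQ] unfolding ordQ by blast
  have uc: "u \<in> carrier G" using u by (simp add: center_carrier)
  \<comment> \<open>The order of \<open>u\<close> divides \<open>N\<close>, so congruences modulo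
    \<open>N\<close> between values of \<open>\<chi>\<close> become equalities of powers of
    \<open>u\<close>.\<close>
  have eqI: "u [^] a = u [^] b" if "int N dvd a - b" for a b :: int
  proof -
    have "int (ord u) dvd int N"
      using u uc by (simp add: pow_eq_id)
    then have "int (ord u) dvd b - a"
      using that by (metis dvd_trans dvd_diff_commute)
    then show ?thesis
      using uc int_pow_eq by blast
  qed
  define f where "f g = u [^] \<chi> (M #> g)" for g
  have "f (g \<otimes> h) = f g \<otimes> f h" if "g \<in> carrier G" "h \<in> carrier G" for g h
  proof -
    have "int N dvd \<chi> (M #> (g \<otimes> h)) - (\<chi> (M #> g) + \<chi> (M #> h))"
      using \<chi>(1) that unfolding Q.additive_mod_def by (auto simp: carrier_FactGroup M.rcos_sum)
    then have "f (g \<otimes> h) = u [^] (\<chi> (M #> g) + \<chi> (M #> h))"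
      unfolding f_def by (rule eqI)
    then show ?thesis
      using uc by (simp add: f_def int_pow_mult)
  qed
  then have 1: "f \<in> hom G G"
    using uc by (auto simp: hom_def f_def)
  have 2: "f ` carrier G \<subseteq> center G"
    unfolding f_def using subgroup_int_pow_closed[OF center_subgroup u(1)] by auto
  have 3: "f g = \<one>" if "g \<in> M" for g
  proof -
    have "int N dvd \<chi> M"
      using Q.additive_mod_one[OF \<chi>(1)] Q.one_closed by simp
    then have "u [^] \<chi> M = u [^] (0::int)" by (intro eqI) simp
    moreover have "M #> g = M" using that M by (simp add: coset_join2)
    ultimately show ?thesis by (simp add: f_def)
  qed
  have 4: "f x = u [^] (N div k)"
    unfolding f_def using eqI[OF \<chi>(2)] by (simp add: int_pow_int)
  show thesis
    using that[OF 1 2] 3 4 by blast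
qed

text \<open>An element \<open>g\<close> of the kernel satisfies \<open>f g = inv g\<close>; this
  makes \<open>g\<close> central, so \<open>inj\<close> forces \<open>g = \<one>\<close>. Finiteness
  turns injectivity into bijectivity.\<close>

lemma central_autoI:
  assumes fin: "finite (carrier G)"
    and f: "f \<in> hom G G" "f ` carrier G \<subseteq> center G"
    and inj: "\<And>z. z \<in> center G \<Longrightarrow> f z = inv z \<Longrightarrow> z = \<one>"
  shows "(\<lambda>g\<in>carrier G. g \<otimes> f g) \<in> central_auto G"
proof -
  interpret f: group_hom G G f using f(1) by unfold_locales
  let ?\<phi> = "\<lambda>g\<in>carrier G. g \<otimes> f g"
  have fc: "f g \<in> center G" if "g \<in> carrier G" for g using f(2) that by blast
  have hom: "?\<phi> \<in> hom G G"
  proof (rule homI)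
    fix g h assume gh: "g \<in> carrier G" "h \<in> carrier G"
    then have "g \<otimes> h \<otimes> (f g \<otimes> f h) = g \<otimes> (h \<otimes> f g) \<otimes> f h"
      by (simp add: m_assoc)
    also have "\<dots> = g \<otimes> (f g \<otimes> h) \<otimes> f h"
      using center_comm[OF fc[OF gh(1)] gh(2)] by simp
    also have "\<dots> = g \<otimes> f g \<otimes> (h \<otimes> f h)"
      using gh by (simp add: m_assoc)
    finally show "?\<phi> (g \<otimes> h) = ?\<phi> g \<otimes> ?\<phi> h"
      using gh by simp
  qed auto
  interpret \<phi>: group_hom G G ?\<phi> using hom by unfold_locales
  have "g = \<one>" if g: "g \<in> carrier G" "?\<phi> g = \<one>" for g
  proof -
    have "g \<otimes> f g = \<one>" using g by simp
    then have fg: "f g = inv g"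
      using g by (metis f.hom_closed inv_equality inv_inv)
    then have "g \<in> center G"
      using subgroup.m_inv_closed[OF center_subgroup fc[OF g(1)]] g by simp
    then show ?thesis using inj fg by blast
  qed
  then have "kernel G G ?\<phi> = {\<one>}"
    using \<phi>.hom_one by (auto simp: kernel_def simp del: restrict_apply)
  then have inj\<phi>: "inj_on ?\<phi> (carrier G)"
    by (rule \<phi>.trivial_ker_imp_inj)
  moreover have "?\<phi> ` carrier G \<subseteq> carrier G" by auto
  ultimately have "bij_betw ?\<phi> (carrier G) (carrier G)"
    using endo_inj_surj[OF fin] by (auto simp: bij_betw_def)
  then have "?\<phi> \<in> auto G"
    using hom by (simp add: auto_def Bij_def)
  moreover have "inv g \<otimes> ?\<phi> g \<in> center G" if "g \<in> carrier G" for g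
    using that fc[OF that] by (simp add: m_assoc[symmetric])
  ultimately show ?thesis
    unfolding central_auto_def by blast
qed

section \<open>Exponents and subgroup orders in p-groups\<close>

lemma prime_power_exponent:
  assumes p: "Factorial_Ring.prime p" and o: "order G = p ^ n"
    and M: "subgroup M G" and g: "g \<in> carrier G"
  obtains e where "e \<le> n" "\<And>j::int. g [^] j \<in> M \<longleftrightarrow> int (p ^ e) dvd j"
proof -
  have fin: "finite (carrier G)"
    using o p order_gt_0_iff_finite by (simp add: prime_gt_0_nat)
  obtain m where m: "0 < m" "\<And>j::int. g [^] j \<in> M \<longleftrightarrow> int m dvd j"
    using least_exponent[OF fin M g] by blast
  have "g [^] int (p ^ n) \<in> M"
    using pow_order_eq_1[OF g] o subgroup.one_closed[OF M] by (simp only: int_pow_int)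
  then have "m dvd p ^ n" using m by (simp only: of_nat_dvd_iff)
  then obtain e where "e \<le> n" "m = p ^ e"
    using divides_primepow_nat[OF p] by blast
  then show thesis using that m(2) by blast
qed

text \<open>Orders modulo \<open>M\<close> are powers of \<open>p\<close> and hence linearly ordered
  by divisibility, so the largest one occurring in \<open>S\<close> is an exponent for all of
  \<open>S\<close>.\<close>

lemma max_prime_power_exponent:
  assumes p: "Factorial_Ring.prime p" and o: "order G = p ^ n"
    and M: "subgroup M G" and S: "S \<subseteq> carrier G" "S \<noteq> {}"
  obtains x e where "x \<in> S" "\<And>j::int. x [^] j \<in> M \<longleftrightarrow> int (p ^ e) dvd j"
    "\<And>g. g \<in> S \<Longrightarrow> g [^] (p ^ e) \<in> M"
proof -
  have "\<forall>g\<in>S. \<exists>e. e \<le> n \<and> (\<forall>j::int. g [^] j \<in> M \<longleftrightarrow> int (p ^ e) dvd j)"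
    using prime_power_exponent[OF p o M] S by (metis subsetD)
  then obtain E where E: "\<And>g. g \<in> S \<Longrightarrow> E g \<le> n"
      "\<And>g j. g \<in> S \<Longrightarrow> g [^] (j::int) \<in> M \<longleftrightarrow> int (p ^ E g) dvd j"
    by metis
  obtain s where s: "s \<in> S" using S by blast
  have "\<exists>x. x \<in> S \<and> (\<forall>g. g \<in> S \<longrightarrow> E g \<le> E x)"
    using s E(1) by (intro ex_has_greatest_nat[of _ s _ "Suc n"]) (auto simp: le_SucI less_Suc_eq_le)
  then obtain x where x: "x \<in> S" "\<And>g. g \<in> S \<Longrightarrow> E g \<le> E x"
    by auto
  have "g [^] (p ^ E x) \<in> M" if "g \<in> S" for g
  proof -
    have "g [^] int (p ^ E x) \<in> M"
      using E(2)[OF that] x(2)[OF that] by (simp add: le_imp_power_dvd)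
    then show ?thesis by (simp only: int_pow_int)
  qed
  then show thesis using that x(1) E(2)[OF x(1)] by blast
qed

text \<open>Both orders are powers of \<open>p\<close>. Each strict step in a chain of subgroups
  therefore costs a factor \<open>p\<close>, which replaces dimension counting later on.\<close>

lemma card_psubgroup_prime_power:
  assumes p: "Factorial_Ring.prime p" and o: "order G = p ^ n"
    and K: "subgroup K G" and L: "subgroup L G" and KL: "K \<subset> L"
  shows "card K * p \<le> card L"
proof -
  have fin: "finite (carrier G)"
    using o p order_gt_0_iff_finite by (simp add: prime_gt_0_nat)
  obtain i j where ij: "card K = p ^ i" "card L = p ^ j"
    using divides_primepow_nat[OF p] lagrange[OF K] lagrange[OF L] o by (metis dvd_triv_right)
  have "card K < card L"
    using KL subgroup.subset[OF L] fin by (meson finite_subset psubset_card_mono)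
  then have "i < j"
    unfolding ij using power_less_imp_less_exp prime_gt_1_nat[OF p] by blast
  then have "p ^ Suc i \<le> p ^ j"
    using prime_gt_0_nat[OF p] by (intro power_increasing) auto
  then show ?thesis using ij by (simp add: mult.commute)
qed

text \<open>The powers of \<open>u\<close> include \<open>ord u\<close> distinct central elements,
  which is enough to fill the center.\<close>

lemma cyclic_group_center:
  assumes fin: "finite (carrier G)" and u: "u \<in> center G" and o: "card (center G) \<le> ord u"
  shows "cyclic_group (G\<lparr>carrier := center G\<rparr>)"
proof -
  have uc: "u \<in> carrier G" using u by (simp add: center_carrier)
  interpret Z: group "G\<lparr>carrier := center G\<rparr>"
    using center_subgroup by (rule subgroup_imp_group)
  have sub: "range (\<lambda>n::int. u [^] n) \<subseteq> center G"
    using subgroup_int_pow_closed[OF center_subgroup u] by auto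
  have finZ: "finite (center G)" using fin center_carrier by (meson finite_subset subsetI)
  have "inj_on (\<lambda>n::int. u [^] n) {0..<int (ord u)}"
    using uc by (auto simp: inj_on_def int_pow_eq) (metis atLeastLessThan_iff mod_eq_dvd_iff mod_pos_pos_trivial)
  then have "ord u \<le> card (range (\<lambda>n::int. u [^] n))"
    using card_inj_on_le[of _ "{0..<int (ord u)}" "range (\<lambda>n::int. u [^] n)"] finite_subset[OF sub finZ] by fastforce
  then have "range (\<lambda>n::int. u [^] n) = center G"
    using card_seteq[OF finZ sub] o by simp
  moreover have "u [^]\<^bsub>G\<lparr>carrier := center G\<rparr>\<^esub> n = u [^] n" for n :: int
    using int_pow_consistent[OF center_subgroup u] by simp
  ultimately show ?thesis
    unfolding Z.cyclic_group using u by (auto intro!: bexI[of _ u])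
qed

end

section \<open>Groups of class at most two\<close>

locale class_two_group = group +
  assumes commutator_central:
    "\<And>x g. x \<in> carrier G \<Longrightarrow> g \<in> carrier G \<Longrightarrow> commutator G x g \<in> center G"
begin

lemma commutator_mult_right:
  assumes "x \<in> carrier G" "g \<in> carrier G" "h \<in> carrier G"
  shows "commutator G x (g \<otimes> h) = commutator G x g \<otimes> commutator G x h"
proof (rule commutator_eqI)
  have "x \<otimes> (g \<otimes> h) = g \<otimes> x \<otimes> commutator G x g \<otimes> h"
    using assms mult_commutator[of x g] by (simp add: m_assoc[symmetric])
  also have "\<dots> = g \<otimes> (x \<otimes> h) \<otimes> commutator G x g"
    using assms center_comm[OF commutator_central[OF assms(1,2)] assms(3)] by (simp add: m_assoc)
  also have "\<dots> = g \<otimes> h \<otimes> x \<otimes> (commutator G x h \<otimes> commutator G x g)"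
    using assms mult_commutator[of x h] by (simp add: m_assoc)
  also have "\<dots> = g \<otimes> h \<otimes> x \<otimes> (commutator G x g \<otimes> commutator G x h)"
    using assms center_comm[OF commutator_central[OF assms(1,2)], of "commutator G x h"] by simp
  finally show "x \<otimes> (g \<otimes> h) = g \<otimes> h \<otimes> x \<otimes> (commutator G x g \<otimes> commutator G x h)" .
qed (use assms in auto)

lemma commutator_swap:
  assumes "x \<in> carrier G" "g \<in> carrier G"
  shows "commutator G g x = inv (commutator G x g)"
proof (rule commutator_eqI)
  have "x \<otimes> g \<otimes> inv (commutator G x g) = g \<otimes> x \<otimes> (commutator G x g \<otimes> inv (commutator G x g))"
    using assms mult_commutator[OF assms] by (simp add: m_assoc del: r_inv)
  then show "g \<otimes> x = x \<otimes> g \<otimes> inv (commutator G x g)"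
    using assms by simp
qed (use assms in auto)

lemma commutator_mult_left:
  assumes "x \<in> carrier G" "y \<in> carrier G" "g \<in> carrier G"
  shows "commutator G (x \<otimes> y) g = commutator G x g \<otimes> commutator G y g"
proof -
  have "commutator G (x \<otimes> y) g = inv (commutator G g x \<otimes> commutator G g y)"
    using assms by (simp add: commutator_swap[of g] commutator_mult_right)
  also have "\<dots> = commutator G y g \<otimes> commutator G x g"
    using assms by (simp add: commutator_swap[of g] inv_mult_group)
  also have "\<dots> = commutator G x g \<otimes> commutator G y g"
    using assms by (intro center_comm commutator_central) auto
  finally show ?thesis .
qed

lemma commutator_hom: "x \<in> carrier G \<Longrightarrow> commutator G x \<in> hom G G"
  by (rule homI) (auto simp: commutator_mult_right)

lemma commutator_pow_left:
  "x \<in> carrier G \<Longrightarrow> g \<in> carrier G \<Longrightarrow> commutator G (x [^] (n::nat)) g = commutator G x g [^] n"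
  by (induction n) (auto simp: commutator_mult_left commutator_central_left
    subgroup.one_closed[OF center_subgroup])

lemma commutator_inv_right:
  "x \<in> carrier G \<Longrightarrow> g \<in> carrier G \<Longrightarrow> commutator G x (inv g) = inv (commutator G x g)"
  using group_hom.hom_inv[of G G "commutator G x"] commutator_hom
  by (simp add: group_hom_def group_hom_axioms_def)

lemma derived_le_center: "derived G (carrier G) \<subseteq> center G"
  using center_subgroup commutator_central by (rule derived_subsetI)

lemma subgroup_commutator_vimage:
  assumes N: "subgroup N G" and x: "x \<in> carrier G"
  shows "subgroup {g \<in> carrier G. commutator G x g \<in> N} G"
proof -
  interpret N: subgroup N G by fact
  have "commutator G x \<one> = \<one>"
    using x by (intro commutator_central_right subgroup.one_closed center_subgroup)
  then show ?thesis
    by (intro subgroupI) (use x in \<open>auto simp: commutator_mult_right commutator_inv_right intro!: exI[of _ \<one>]\<close>)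
qed

lemma subgroup_commutators:
  assumes x: "x \<in> carrier G"
  shows "subgroup (commutator G x ` carrier G) G"
  using group_hom.img_is_subgroup[of G G "commutator G x"] commutator_hom[OF x]
  by (simp add: group_hom_def group_hom_axioms_def)

text \<open>The image lies in the center, where all commutators are trivial.\<close>

lemma hom_kills_derived:
  assumes f: "f \<in> hom G G" "f ` carrier G \<subseteq> center G" and d: "d \<in> derived G (carrier G)"
  shows "f d = \<one>"
proof -
  interpret f: group_hom G G f using f(1) by unfold_locales
  have fc: "f g \<in> center G" if "g \<in> carrier G" for g using f(2) that by blast
  have "derived G (carrier G) \<subseteq> kernel G G f"
  proof (rule derived_subsetI[OF f.subgroup_kernel])
    fix x g assume xg: "x \<in> carrier G" "g \<in> carrier G"
    have "f (commutator G x g) = commutator G (f x) (f g)"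
      using xg by (simp add: commutator_def)
    then show "commutator G x g \<in> kernel G G f"
      using xg fc by (simp add: kernel_def commutator_central_left)
  qed
  then show ?thesis using d by (auto simp: kernel_def)
qed

text \<open>For a commutator, bilinearity gives \<open>[x,g]^N = [x^N,g] = 1\<close>. The central
  elements killed by \<open>N\<close> form a subgroup, so the bound passes to everything that
  commutators generate.\<close>

lemma derived_exponent:
  assumes N: "\<And>g. g \<in> carrier G \<Longrightarrow> g [^] (N::nat) \<in> center G" and d: "d \<in> derived G (carrier G)"
  shows "d [^] N = \<one>"
proof -
  have "subgroup {z \<in> center G. z [^] N = \<one>} G"
  proof (rule subgroupI)
    show "{z \<in> center G. z [^] N = \<one>} \<subseteq> carrier G" by (auto simp: center_carrier)
    show "{z \<in> center G. z [^] N = \<one>} \<noteq> {}"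
      using subgroup.one_closed[OF center_subgroup] by (auto intro!: exI[of _ \<one>])
  next
    fix a assume "a \<in> {z \<in> center G. z [^] N = \<one>}"
    then show "inv a \<in> {z \<in> center G. z [^] N = \<one>}"
      by (auto simp: subgroup.m_inv_closed[OF center_subgroup] center_carrier nat_pow_inv)
  next
    fix a b assume ab: "a \<in> {z \<in> center G. z [^] N = \<one>}" "b \<in> {z \<in> center G. z [^] N = \<one>}"
    then have "(a \<otimes> b) [^] N = a [^] N \<otimes> b [^] N"
      by (intro pow_mult_distrib center_comm) (auto simp: center_carrier)
    then show "a \<otimes> b \<in> {z \<in> center G. z [^] N = \<one>}"
      using ab by (auto simp: subgroup.m_closed[OF center_subgroup])
  qed
  moreover have "commutator G x g \<in> {z \<in> center G. z [^] N = \<one>}"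
    if "x \<in> carrier G" "g \<in> carrier G" for x g
    using that N[OF that(1)] by (simp add: commutator_central commutator_central_left flip: commutator_pow_left)
  ultimately show ?thesis
    using derived_subsetI d by blast
qed

text \<open>A class preserving map multiplies each \<open>x\<close> by a commutator of
  \<open>x\<close>, which is central.\<close>

lemma class_preserving_subset_central:
  "class_preserving_auto G \<subseteq> central_auto G"
proof
  fix \<alpha> assume \<alpha>: "\<alpha> \<in> class_preserving_auto G"
  then have "\<exists>g\<in>carrier G. inv x \<otimes> \<alpha> x = commutator G x g" if "x \<in> carrier G" for x
    using that unfolding class_preserving_auto_def commutator_def by fastforce
  then show "\<alpha> \<in> central_auto G"
    using \<alpha> commutator_central unfolding class_preserving_auto_def central_auto_def by fastforce
qed

text \<open>\<open>inv g \<otimes> \<phi> g\<close> is a homomorphism into the center which kills \<open>\<gamma>\<^sub>2(G) = Z(G)\<close>, so its value at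
  \<open>x\<close> has order dividing that of \<open>x\<close> modulo the center, which is also the order of \<open>[x,G]\<close>.  A cyclic
  group has at most one subgroup of a given order.\<close>
lemma central_subset_class_preserving:
  assumes fin: "finite (carrier G)" and D: "derived G (carrier G) = center G"
    and cyc: "cyclic_group (G\<lparr>carrier := center G\<rparr>)"
  shows "central_auto G \<subseteq> class_preserving_auto G"
proof
  fix \<phi> assume \<phi>: "\<phi> \<in> central_auto G"
  then have "\<phi> \<in> hom G G" and aut: "\<phi> \<in> auto G" by (auto simp: central_auto_def auto_def)
  then interpret \<phi>: group_hom G G \<phi> by unfold_locales
  define f where "f g = inv g \<otimes> \<phi> g" for g
  have fc: "f g \<in> center G" if "g \<in> carrier G" for g
    using \<phi> that by (simp add: central_auto_def f_def)
  have "f (g \<otimes> h) = f g \<otimes> f h" if gh: "g \<in> carrier G" "h \<in> carrier G" for g h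
  proof -
    have "f (g \<otimes> h) = inv h \<otimes> f g \<otimes> \<phi> h"
      using gh by (simp add: f_def inv_mult_group m_assoc)
    also have "\<dots> = f g \<otimes> inv h \<otimes> \<phi> h"
      using center_comm[OF fc[OF gh(1)], of "inv h"] gh by simp
    also have "\<dots> = f g \<otimes> f h"
      using gh by (simp add: f_def m_assoc)
    finally show ?thesis .
  qed
  then have fhom: "f \<in> hom G G"
    using fc center_carrier by (auto intro!: homI)
  interpret f: group_hom G G f using fhom by unfold_locales
  have fZ: "f z = \<one>" if "z \<in> center G" for z
    using hom_kills_derived[OF fhom] fc that D by blast
  interpret Z: group "G\<lparr>carrier := center G\<rparr>"
    using center_subgroup by (rule subgroup_imp_group)
  obtain u where u: "u \<in> center G"
    and "center G = range (\<lambda>n::int. u [^]\<^bsub>G\<lparr>carrier := center G\<rparr>\<^esub> n)"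
    using cyc unfolding Z.cyclic_group by auto
  then have Zu: "center G = range (\<lambda>n::int. u [^] n)"
    using int_pow_consistent[OF center_subgroup u] by simp
  have uc: "u \<in> carrier G" using u by (rule center_carrier)
  have pw: "(u [^] j) [^] m = u [^] (j * int m)" for j :: int and m :: nat
    using int_pow_pow[OF uc, of j "int m"] by (simp add: int_pow_int)
  have "\<exists>g\<in>carrier G. \<phi> x = inv g \<otimes> x \<otimes> g" if x: "x \<in> carrier G" for x
  proof -
    let ?S = "commutator G x ` carrier G"
    \<comment> \<open>The subgroup \<open>?S = [x,G]\<close> of the cyclic center consists of the
      powers of \<open>u [^] k\<close>, and \<open>m = ord u div k\<close> is its order.\<close>
    obtain k where k: "0 < k" "\<And>j::int. u [^] j \<in> ?S \<longleftrightarrow> int k dvd j"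
      using least_exponent[OF fin subgroup_commutators[OF x] uc] by blast
    have "u [^] int (ord u) \<in> ?S"
      using subgroup.one_closed[OF subgroup_commutators[OF x]] uc by (simp add: int_pow_int)
    then have "k dvd ord u"
      using k(2) by (simp only: of_nat_dvd_iff)
    then obtain m where m: "ord u = k * m" ..
    have m0: "m \<noteq> 0" using ord_ge_1[OF fin uc] m by auto
    have "x [^] m \<in> center G"
    proof (rule centerI)
      fix g assume g: "g \<in> carrier G"
      obtain j :: int where j: "commutator G x g = u [^] j"
        using commutator_central[OF x g] unfolding Zu by (rule rangeE)
      have "u [^] j \<in> ?S" unfolding j[symmetric] using g by (rule imageI)
      then have "int k dvd j" by (simp only: k(2))
      then have "int (ord u) dvd j * int m" using m by simp
      then have "u [^] (j * int m) = \<one>" using uc by (simp add: int_pow_eq_id)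
      then show "commutator G (x [^] m) g = \<one>"
        using commutator_pow_left[OF x g, of m] j pw by simp
    qed (use x in simp)
    \<comment> \<open>As \<open>f\<close> kills the center, \<open>f x\<close> has order dividing
      \<open>m\<close>. Written as \<open>u [^] j\<close>, this forces \<open>k\<close> to divide
      \<open>j\<close>, which is membership in \<open>?S\<close>.\<close>
    then have "f x [^] m = \<one>"
      using fZ f.hom_nat_pow[OF x] by metis
    moreover obtain j :: int where j: "f x = u [^] j"
      using fc[OF x] unfolding Zu by (rule rangeE)
    ultimately have "u [^] (j * int m) = \<one>"
      using pw by simp
    then have "int (k * m) dvd j * int m"
      using uc m by (simp add: int_pow_eq_id)
    then have "int k dvd j" using m0 by simp
    then obtain g where g: "g \<in> carrier G" "f x = commutator G x g"
      using k(2) j by auto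
    then have "\<phi> x = inv g \<otimes> x \<otimes> g"
      using x by (simp add: f_def commutator_def)
    then show ?thesis using g by blast
  qed
  then show "\<phi> \<in> class_preserving_auto G"
    using aut unfolding class_preserving_auto_def by blast
qed

end

section \<open>Nonabelian p-groups whose central automorphisms preserve classes\<close>

text \<open>One inclusion between the two automorphism groups is an assumption; the other enters
  through class two.\<close>

locale central_class_preserving_p_group = class_two_group +
  fixes p n :: nat
  assumes prime: "Factorial_Ring.prime p"
    and order: "order G = p ^ n"
    and nonabelian: "center G \<noteq> carrier G"
    and central_class_preserving: "central_auto G \<subseteq> class_preserving_auto G"
begin

lemma finite_carrier: "finite (carrier G)"
  using order prime order_gt_0_iff_finite by (simp add: prime_gt_0_nat)

lemma center_subset: "center G \<subseteq> carrier G"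
  by (auto simp: center_carrier)

lemma finite_center: "finite (center G)"
  using center_subset finite_carrier by (rule finite_subset)

lemma center_nonempty: "center G \<noteq> {}"
  using subgroup.one_closed[OF center_subgroup] by blast

lemma carrier_nonempty: "carrier G \<noteq> {}"
  using one_closed by (metis empty_iff)

text \<open>The map \<open>g \<mapsto> g \<otimes> f g\<close> is a central automorphism, hence
  class preserving. So \<open>x \<otimes> f x\<close> is a conjugate of \<open>x\<close>, and
  \<open>f x\<close> is the corresponding commutator.\<close>

lemma hom_value_commutator:
  assumes "f \<in> hom G G" "f ` carrier G \<subseteq> center G"
    and "\<And>z. z \<in> center G \<Longrightarrow> f z = inv z \<Longrightarrow> z = \<one>" and x: "x \<in> carrier G"
  shows "f x \<in> commutator G x ` carrier G"
proof -
  have fx: "f x \<in> carrier G" using assms(1) x by (auto simp: hom_def)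
  have "(\<lambda>g\<in>carrier G. g \<otimes> f g) \<in> class_preserving_auto G"
    using central_autoI[OF finite_carrier assms(1-3)] central_class_preserving by blast
  then obtain g where g: "g \<in> carrier G" "x \<otimes> f x = inv g \<otimes> x \<otimes> g"
    using x unfolding class_preserving_auto_def by auto
  then have "f x = commutator G x g"
    using x fx unfolding commutator_def by (metis inv_closed inv_solve_left m_closed)
  then show ?thesis using g by blast
qed

text \<open>With \<open>N\<close> both the order of \<open>x\<close> and an exponent modulo the
  center, some homomorphism kills the center and takes \<open>x\<close> to \<open>z\<close>. On the
  center \<open>f w = inv w\<close> then reads \<open>\<one> = inv w\<close>, so the automorphism
  criterion holds.\<close>

lemma center_element_commutator:
  assumes N: "0 < N" "\<And>g. g \<in> carrier G \<Longrightarrow> g [^] N \<in> center G"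
    and x: "x \<in> carrier G" "\<And>j::int. x [^] j \<in> center G \<longleftrightarrow> int N dvd j"
    and z: "z \<in> center G" "z [^] N = \<one>"
  shows "z \<in> commutator G x ` carrier G"
proof -
  obtain f where f: "f \<in> hom G G" "f ` carrier G \<subseteq> center G" "\<forall>g\<in>center G. f g = \<one>"
    "f x = z [^] (N div N)"
    by (rule hom_to_center[OF finite_carrier center_subgroup commutator_central N x z])
  have "f x \<in> commutator G x ` carrier G"
  proof (rule hom_value_commutator[OF f(1,2) _ x(1)])
    fix w assume "w \<in> center G" "f w = inv w"
    then show "w = \<one>" using f(3) center_carrier by (metis inv_inv inv_one)
  qed
  then show ?thesis
    using f(4) N(1) z center_carrier by simp
qed

lemma center_exponent:
  obtains x e where "x \<in> carrier G" "0 < e" "\<And>j::int. x [^] j \<in> center G \<longleftrightarrow> int (p ^ e) dvd j"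
    "\<And>g. g \<in> carrier G \<Longrightarrow> g [^] (p ^ e) \<in> center G"
proof -
  obtain x e where x: "x \<in> carrier G" "\<And>j::int. x [^] j \<in> center G \<longleftrightarrow> int (p ^ e) dvd j"
    "\<And>g. g \<in> carrier G \<Longrightarrow> g [^] (p ^ e) \<in> center G"
    by (rule max_prime_power_exponent[OF prime order center_subgroup subset_refl carrier_nonempty]) (rule that; blast)
  have "0 < e"
  proof (rule ccontr)
    assume "\<not> 0 < e"
    then have "carrier G \<subseteq> center G" using x(3) by fastforce
    then show False using nonabelian center_carrier by blast
  qed
  then show thesis using that x by blast
qed

text \<open>Suppose \<open>w\<close> is central outside \<open>?D\<close>. Central elements killed
  by \<open>p ^ e\<close> lie in \<open>?D\<close> (\<open>Omega\<close>); therefore every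
  homomorphism into the center yields an automorphism (\<open>inj\<close>), takes values in
  \<open>?D\<close> and kills the center (\<open>fval\<close>). Comparing the exponent of the center
  with that of the quotient by \<open>?D\<close> produces a homomorphism for which this fails, or
  puts \<open>w\<close> into \<open>?D\<close>.\<close>

lemma derived_eq_center: "derived G (carrier G) = center G"
proof (rule ccontr)
  let ?D = "derived G (carrier G)"
  assume "?D \<noteq> center G"
  then obtain w where w: "w \<in> center G" "w \<notin> ?D" using derived_le_center by blast
  have wc: "w \<in> carrier G" using w center_carrier by blast
  have Dsub: "subgroup ?D G" by (rule derived_is_subgroup) simp
  obtain x e where x: "x \<in> carrier G" "0 < e" "\<And>j::int. x [^] j \<in> center G \<longleftrightarrow> int (p ^ e) dvd j"
    "\<And>g. g \<in> carrier G \<Longrightarrow> g [^] (p ^ e) \<in> center G"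
    by (rule center_exponent) (rule that; blast)
  have p0: "0 < p ^ i" for i using prime by (simp add: prime_gt_0_nat)
  have Omega: "z \<in> ?D" if "z \<in> center G" "z [^] (p ^ e) = \<one>" for z
    using center_element_commutator[OF p0 x(4,1,3) that] commutator_in_derived[OF x(1)] by blast
  have inj: "z = \<one>"
    if f: "f \<in> hom G G" "f ` carrier G \<subseteq> center G" and z: "z \<in> center G" "f z = inv z" for f z
  proof (rule ccontr)
    assume z1: "z \<noteq> \<one>"
    interpret f: group_hom G G f using f(1) by unfold_locales
    have zc: "z \<in> carrier G" using z center_carrier by blast
    obtain i where i: "ord z = p ^ i"
      using divides_primepow_nat[OF prime] ord_dvd_group_order[OF zc] order by auto
    have "i \<noteq> 0" using i z1 zc ord_eq_1 by (metis power_0)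
    then obtain q where q: "i = Suc q" using not0_implies_Suc by blast
    \<comment> \<open>This power of \<open>z\<close> has order \<open>p\<close>. Since
      \<open>0 < e\<close>, it falls under \<open>Omega\<close>, so \<open>f\<close> kills it,
      although \<open>f\<close> also inverts it.\<close>
    define y where "y = z [^] (p ^ q)"
    have yZ: "y \<in> center G" "y \<in> carrier G"
      using z zc subgroup_int_pow_closed[OF center_subgroup z(1), of "int (p ^ q)"]
      by (simp_all only: y_def int_pow_int nat_pow_closed)
    have "z [^] (p ^ q * p ^ e) = \<one>"
      unfolding pow_eq_id[OF zc] i q power_add[symmetric] using x(2) by (intro le_imp_power_dvd) simp
    then have "y [^] (p ^ e) = \<one>" using zc by (simp add: y_def nat_pow_pow)
    then have "f y = \<one>"
      using Omega yZ(1) hom_kills_derived[OF f] by blast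
    moreover have "f y = inv y"
      using zc z by (simp add: y_def f.hom_nat_pow nat_pow_inv)
    ultimately have "y = \<one>" using yZ by (metis inv_inv inv_one)
    then have "p ^ Suc q dvd p ^ q"
      using zc i q by (simp only: y_def pow_eq_id)
    then show False
      using power_dvd_imp_le[of p "Suc q" q] prime_gt_1_nat[OF prime] by simp
  qed
  have fval: "f g \<in> ?D" "g \<in> center G \<Longrightarrow> f g = \<one>"
    if f: "f \<in> hom G G" "f ` carrier G \<subseteq> center G" and g: "g \<in> carrier G" for f g
  proof -
    have "f g \<in> commutator G g ` carrier G"
      by (rule hom_value_commutator[OF f inj[OF f] g])
    then obtain h where h: "h \<in> carrier G" "f g = commutator G g h" by auto
    show "f g \<in> ?D" using commutator_in_derived[OF g h(1)] h(2) by simp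
    show "f g = \<one>" if "g \<in> center G" using commutator_central_left[OF that h(1)] h(2) by simp
  qed
  \<comment> \<open>Modulo the trivial subgroup this is the ordinary order: \<open>p ^ m\<close> is
    the exponent of the center, attained by \<open>u\<close>. Likewise \<open>p ^ c\<close> below is
    the exponent modulo \<open>?D\<close>, attained by \<open>a\<close>.\<close>
  obtain u m where u: "u \<in> center G" "\<And>j::int. u [^] j \<in> {\<one>} \<longleftrightarrow> int (p ^ m) dvd j"
    "\<And>z. z \<in> center G \<Longrightarrow> z [^] (p ^ m) \<in> {\<one>}"
    by (rule max_prime_power_exponent[OF prime order triv_subgroup center_subset center_nonempty]) (rule that; blast)
  have uc: "u \<in> carrier G" using u center_carrier by blast
  obtain a c where a: "a \<in> carrier G" "\<And>j::int. a [^] j \<in> ?D \<longleftrightarrow> int (p ^ c) dvd j"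
    "\<And>g. g \<in> carrier G \<Longrightarrow> g [^] (p ^ c) \<in> ?D"
    by (rule max_prime_power_exponent[OF prime order Dsub subset_refl carrier_nonempty]) (rule that; blast)
  have um: "u [^] (p ^ m) = \<one>" using u by blast
  show False
  proof (cases "c \<le> m")
    case True
    have Dm: "g [^] (p ^ m) \<in> ?D" if "g \<in> carrier G" for g
    proof -
      have "g [^] (p ^ m) = (g [^] (p ^ c)) [^] (p ^ (m - c))"
        using that True by (simp add: nat_pow_pow flip: power_add)
      then show ?thesis
        using subgroup_int_pow_closed[OF Dsub a(3)[OF that], of "int (p ^ (m - c))"]
        by (simp only: int_pow_int)
    qed
    obtain i where i: "i \<le> n" "\<And>j::int. w [^] j \<in> ?D \<longleftrightarrow> int (p ^ i) dvd j"
      by (rule prime_power_exponent[OF prime order Dsub wc]) (rule that; blast)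
    \<comment> \<open>Here \<open>p ^ i\<close> is the order of \<open>w\<close> modulo
      \<open>?D\<close>, and \<open>f w\<close> has the same order because \<open>u\<close> has
      order \<open>p ^ m\<close>. But \<open>f\<close> kills the central element \<open>w\<close>,
      so \<open>i = 0\<close> and \<open>w\<close> lies in \<open>?D\<close>.\<close>
    obtain f where f: "f \<in> hom G G" "f ` carrier G \<subseteq> center G" "\<forall>g\<in>?D. f g = \<one>" "f w = u [^] (p ^ m div p ^ i)"
      by (rule hom_to_center[OF finite_carrier Dsub commutator_in_derived p0 Dm wc i(2) u(1) um])
    have "f w = \<one>" using fval(2)[OF f(1,2) wc w(1)] .
    then have "u [^] int (p ^ m div p ^ i) \<in> {\<one>}" using f(4) by (simp only: int_pow_int singletonI)
    then have "p ^ m dvd p ^ m div p ^ i" using u(2) by (simp only: of_nat_dvd_iff)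
    moreover have "w [^] int (p ^ m) \<in> ?D" using Dm[OF wc] by (simp only: int_pow_int)
    then have "p ^ i dvd p ^ m" using i(2) by (simp only: of_nat_dvd_iff)
    then obtain r where r: "p ^ m = p ^ i * r" ..
    then have "p ^ m div p ^ i = r"
      using nonzero_mult_div_cancel_left[of "p ^ i" r] p0[of i] by (simp only:)
    ultimately have "p ^ i * r dvd r" using r by (simp only:)
    moreover have r0: "0 < r" using r p0[of m] by (simp only: mult_0_right neq0_conv[symmetric]) auto
    ultimately have "p ^ i * r \<le> 1 * r" by (simp add: dvd_imp_le)
    then have "p ^ i \<le> 1" using r0 by (simp only: mult_le_cancel2)
    then have "p ^ i = 1" using p0[of i] by linarith
    moreover have "w [^] int (p ^ i) \<in> ?D" using i(2) by (simp only: dvd_refl)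
    ultimately have "w \<in> ?D" using wc by (simp only: int_pow_int nat_pow_eone)
    then show False using w by blast
  next
    case False
    have uc': "u [^] (p ^ c) = \<one>"
    proof -
      have "p ^ m dvd p ^ c" by (rule le_imp_power_dvd) (use False in linarith)
      then have "u [^] int (p ^ c) \<in> {\<one>}" using u(2) by (simp only: of_nat_dvd_iff)
      then show ?thesis by (simp only: int_pow_int singleton_iff)
    qed
    \<comment> \<open>Now \<open>a\<close> can be sent to \<open>u\<close> itself, which puts
      \<open>u\<close> into \<open>?D\<close>. The exponent of \<open>?D\<close> divides
      \<open>p ^ e\<close>, so the whole center has exponent dividing \<open>p ^ e\<close>, and
      \<open>Omega\<close> captures \<open>w\<close>.\<close>
    obtain f where f: "f \<in> hom G G" "f ` carrier G \<subseteq> center G" "\<forall>g\<in>?D. f g = \<one>" "f a = u [^] (p ^ c div p ^ c)"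
      by (rule hom_to_center[OF finite_carrier Dsub commutator_in_derived p0 a(3,1,2) u(1) uc'])
    have "p ^ c div p ^ c = 1" using p0[of c] by simp
    then have "f a = u" using f(4) uc by (simp only: nat_pow_eone)
    then have "u \<in> ?D" using fval(1)[OF f(1,2) a(1)] by simp
    then have "u [^] int (p ^ e) \<in> {\<one>}"
      using derived_exponent[OF x(4)] by (simp only: int_pow_int singleton_iff)
    then have "p ^ m dvd p ^ e" using u(2) by (simp only: of_nat_dvd_iff)
    then obtain r where r: "p ^ e = p ^ m * r" ..
    have "w [^] (p ^ m) = \<one>" using u(3) w by blast
    then have "w [^] (p ^ e) = \<one>" using r wc by (simp flip: nat_pow_pow)
    then show False using Omega w by blast
  qed
qed

text \<open>Because the center equals the commutator subgroup, it is killed by every exponent of the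
  quotient by the center, so \<open>center_element_commutator\<close> applies to all its
  elements.\<close>

lemma commutators_eq_center:
  assumes N: "0 < N" "\<And>g. g \<in> carrier G \<Longrightarrow> g [^] N \<in> center G"
    and x: "x \<in> carrier G" "\<And>j::int. x [^] j \<in> center G \<longleftrightarrow> int N dvd j"
  shows "commutator G x ` carrier G = center G"
proof
  show "commutator G x ` carrier G \<subseteq> center G"
    using commutator_central x by blast
  show "center G \<subseteq> commutator G x ` carrier G"
  proof
    fix z assume z: "z \<in> center G"
    then have "z [^] N = \<one>"
      using derived_exponent[OF N(2)] derived_eq_center by blast
    then show "z \<in> commutator G x ` carrier G"
      using center_element_commutator[OF N x z] by blast
  qed
qed

lemma exists_commutators_eq_center:
  obtains x where "x \<in> carrier G" "x \<notin> center G" "commutator G x ` carrier G = center G"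
proof -
  obtain x e where x: "x \<in> carrier G" "0 < e" "\<And>j::int. x [^] j \<in> center G \<longleftrightarrow> int (p ^ e) dvd j"
    "\<And>g. g \<in> carrier G \<Longrightarrow> g [^] (p ^ e) \<in> center G"
    by (rule center_exponent) (rule that; blast)
  have "x \<notin> center G"
  proof
    assume "x \<in> center G"
    then have "int (p ^ e) dvd int 1" using x(3)[of 1] x(1) by simp
    then have "p ^ e dvd 1" by (simp only: of_nat_dvd_iff)
    then show False using x(2) prime_gt_1_nat[OF prime] by simp
  qed
  moreover have "commutator G x ` carrier G = center G"
    using prime x by (intro commutators_eq_center[of "p ^ e"]) (auto simp: prime_gt_0_nat)
  ultimately show thesis using that x(1) by blast
qed

text \<open>For suitable noncentral \<open>x\<close>, the map \<open>g \<mapsto> [x,g]\<close> is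
  onto the center with kernel the centralizer of \<open>x\<close>, whence
  \<open>|G| = |Z(G)| * |C(x)|\<close>. The centralizer contains \<open>x\<close> besides the
  center, so its order is at least \<open>p * |Z(G)|\<close>.\<close>

lemma card_center_bound:
  assumes a: "card (center G) = p ^ a"
  shows "2 * a < n"
proof -
  obtain x where x: "x \<in> carrier G" "x \<notin> center G" "commutator G x ` carrier G = center G"
    by (rule exists_commutators_eq_center)
  let ?H = "G\<lparr>carrier := center G\<rparr>"
  have "commutator G x \<in> hom G ?H"
    by (rule homI) (use x(1) commutator_central commutator_mult_right in auto)
  then interpret h: group_hom G ?H "commutator G x"
    using subgroup_imp_group[OF center_subgroup] by (simp add: group_hom_def group_hom_axioms_def)
  let ?C = "kernel G ?H (commutator G x)"
  have "G Mod ?C \<cong> ?H" by (rule h.FactGroup_iso) (use x(3) in simp)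
  then have "card (rcosets ?C) = p ^ a"
    using iso_same_card a by (fastforce simp: FactGroup_def)
  then have C: "p ^ a * card ?C = p ^ n"
    using lagrange[OF h.subgroup_kernel] order by simp
  have "center G \<subset> ?C"
    using x commutator_central_right[OF _ x(1)] commutator_self[OF x(1)] center_carrier
    by (auto simp: kernel_def)
  then have "p ^ a * p \<le> card ?C"
    using card_psubgroup_prime_power[OF prime order center_subgroup h.subgroup_kernel] a by simp
  then have "p ^ a * (p ^ a * p) \<le> p ^ n"
    using C by (metis mult_le_mono2)
  then have "p ^ (a + a + 1) \<le> p ^ n"
    by (simp add: power_add mult_ac)
  then have "a + a + 1 \<le> n"
    by (rule power_le_imp_le_exp[OF prime_gt_1_nat[OF prime]])
  then show ?thesis
    by simp
qed

end

section \<open>Cyclicity of the center\<close>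

context central_class_preserving_p_group
begin

text \<open>Modulo \<open>N\<close> the commutator acts as an alternating form on a quotient of
  order \<open>p ^ 3\<close>, and \<open>?D x\<close> is the orthogonal complement of
  \<open>x\<close>. Given \<open>x\<close> and \<open>w\<close> with nonzero pairing, some
  noncentral \<open>t\<close> is orthogonal to both; counting shows that it is orthogonal to
  everything.\<close>

lemma commutators_not_onto_center_order_p5:
  assumes Z: "card (center G) = p ^ 2" and n: "n = 5"
    and onto: "\<And>x. x \<in> carrier G \<Longrightarrow> x \<notin> center G \<Longrightarrow> commutator G x ` carrier G = center G"
    and N: "subgroup N G" "N \<subseteq> center G" "card N = p"
  shows False
proof -
  have p1: "1 < p" using prime by (rule prime_gt_1_nat)
  interpret N: subgroup N G by fact
  interpret Z: group "G\<lparr>carrier := center G\<rparr>"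
    using center_subgroup by (rule subgroup_imp_group)
  let ?D = "\<lambda>x. {g \<in> carrier G. commutator G x g \<in> N}"
  have D: "subgroup (?D x) G" if "x \<in> carrier G" for x
    using N(1) that by (rule subgroup_commutator_vimage)
  \<comment> \<open>Nondegeneracy: a noncentral \<open>t\<close> orthogonal to all of
    \<open>G\<close> would give \<open>center G = [t,G] \<subseteq> N\<close>, contradicting the
    orders.\<close>
  have full: False if t: "t \<in> carrier G" "t \<notin> center G" "?D t = carrier G" for t
  proof -
    have "commutator G t ` carrier G \<subseteq> N" using t(3) by blast
    then have "center G \<subseteq> N" using onto[OF t(1,2)] by simp
    then have "card (center G) \<le> card N"
      using N(2) finite_center by (intro card_mono) (auto intro: finite_subset)
    then show False using Z N(3) p1 by (simp add: power2_eq_square)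
  qed
  obtain x where x: "x \<in> carrier G" "x \<notin> center G"
    by (rule exists_commutators_eq_center)
  obtain w where w: "w \<in> carrier G" "commutator G x w \<notin> N"
    using full[OF x] by blast
  define R where "R = (\<lambda>z. N #> z) ` center G"
  have "rcosets\<^bsub>G\<lparr>carrier := center G\<rparr>\<^esub> N = R"
    unfolding R_def RCOSETS_def r_coset_def by auto
  then have "card R * p = p ^ 2"
    using Z.lagrange[OF subgroup_incl[OF N(1) center_subgroup N(2)]] Z N(3) by (simp add: order_def)
  then have cardR: "card R = p" using p1 by (simp add: power2_eq_square)
  have finR: "finite R" using finite_center by (simp add: R_def)
  \<comment> \<open>Some fiber of \<open>\<phi>\<close> has at least \<open>p\<^sup>3\<close> elements, more than the center; quotients of two elements of a
    fiber lie in \<open>?D x \<inter> ?D w\<close>.\<close>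
  define \<phi> where "\<phi> g = (N #> commutator G x g, N #> commutator G w g)" for g
  have "\<phi> \<in> carrier G \<rightarrow> R \<times> R"
    using x w commutator_central by (auto simp: \<phi>_def R_def)
  moreover have "R \<times> R \<noteq> {}" using center_nonempty by (simp add: R_def)
  ultimately obtain y where y: "card (carrier G) \<le> card (\<phi> -` {y} \<inter> carrier G) * card (R \<times> R)"
    using pigeonhole_card[of \<phi> "carrier G" "R \<times> R"] finite_carrier finR by auto
  define F where "F = \<phi> -` {y} \<inter> carrier G"
  have "p ^ 5 \<le> card F * p ^ 2"
    using y order n cardR by (simp add: F_def order_def card_cartesian_product power2_eq_square)
  moreover have "p ^ 5 = p ^ 3 * p ^ 2" by (simp flip: power_add)
  ultimately have "p ^ 3 * p ^ 2 \<le> card F * p ^ 2" by (simp only:)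
  then have F3: "p ^ 3 \<le> card F" using p1 by (simp only: mult_le_cancel2 zero_less_power)
  have "p ^ 2 < p ^ 3" using p1 by (intro power_strict_increasing) auto
  then have F: "card (center G) < card F" using F3 Z by simp
  then have "F \<noteq> {}" by auto
  then obtain h where h: "h \<in> F" by blast
  then have hc: "h \<in> carrier G" by (simp add: F_def)
  have "inj_on (\<lambda>g. inv h \<otimes> g) F"
    using hc by (auto simp: inj_on_def F_def)
  then have "card ((\<lambda>g. inv h \<otimes> g) ` F) = card F" by (rule card_image)
  then have "\<not> (\<lambda>g. inv h \<otimes> g) ` F \<subseteq> center G"
    using F card_mono[OF finite_center] by (metis linorder_not_le)
  then obtain g where g: "g \<in> F" and notZ: "inv h \<otimes> g \<notin> center G" by blast
  define t where "t = inv h \<otimes> g"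
  have gc: "g \<in> carrier G" using g by (simp add: F_def)
  have t: "t \<in> carrier G" "t \<notin> center G" using gc hc notZ by (auto simp: t_def)
  have "commutator G v t \<in> N"
    if v: "v \<in> carrier G" and eq: "N #> commutator G v h = N #> commutator G v g" for v
  proof -
    have "commutator G v g \<in> N #> commutator G v h"
      unfolding eq using v gc by (intro rcos_self N(1)) auto
    then obtain c where c: "c \<in> N" "commutator G v g = c \<otimes> commutator G v h"
      by (auto simp: r_coset_def)
    have "commutator G v t = inv (commutator G v h) \<otimes> (commutator G v h \<otimes> c)"
      using v gc hc c center_comm[of c "commutator G v h"] N(2)
      by (auto simp: t_def commutator_mult_right commutator_inv_right)
    then show ?thesis using v hc c by (simp add: m_assoc[symmetric])
  qed
  moreover have "N #> commutator G x h = N #> commutator G x g" "N #> commutator G w h = N #> commutator G w g"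
    using g h by (auto simp: F_def \<phi>_def)
  ultimately have xt: "commutator G x t \<in> N" and wt: "commutator G w t \<in> N"
    using x(1) w(1) by blast+
  have swap: "commutator G b a \<in> N \<longleftrightarrow> commutator G a b \<in> N"
    if "a \<in> carrier G" "b \<in> carrier G" for a b
    using that commutator_swap N.m_inv_closed by metis
  \<comment> \<open>The chain \<open>Z(G) \<subset> ?S1 \<subset> ?S2 \<subset> ?D t\<close> is strict, so \<open>?D t\<close> has order at least \<open>p\<^sup>5\<close>, i.e. is all of \<open>G\<close>.\<close>
  let ?S1 = "?D t \<inter> ?D x \<inter> ?D w" and ?S2 = "?D t \<inter> ?D x"
  have S2: "subgroup ?S2 G"
    by (rule subgroups_Inter_pair[OF D[OF t(1)] D[OF x(1)]])
  have S1: "subgroup ?S1 G"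
    by (rule subgroups_Inter_pair[OF S2 D[OF w(1)]])
  have "center G \<subseteq> ?S1"
    using t x w center_carrier commutator_central_right by auto
  moreover have "t \<in> ?S1" using t xt wt by (simp add: commutator_self)
  ultimately have "center G \<subset> ?S1" using t(2) by blast
  then have 1: "p ^ 2 * p \<le> card ?S1"
    using card_psubgroup_prime_power[OF prime order center_subgroup S1] Z by simp
  \<comment> \<open>The pairing of \<open>x\<close> with \<open>w\<close> is nonzero, so
    \<open>x\<close> separates \<open>?S2\<close> from \<open>?S1\<close>, and \<open>w\<close> in
    turn separates \<open>?D t\<close> from \<open>?S2\<close>.\<close>
  have "x \<in> ?S2" "x \<notin> ?S1"
    using x w xt swap[OF x(1) t(1)] swap[OF x(1) w(1)] by (auto simp: commutator_self)
  then have "?S1 \<subset> ?S2" by blast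
  then have 2: "card ?S1 * p \<le> card ?S2"
    by (rule card_psubgroup_prime_power[OF prime order S1 S2])
  have "w \<in> ?D t" "w \<notin> ?S2"
    using w wt swap[OF w(1) t(1)] by auto
  then have "?S2 \<subset> ?D t" by blast
  then have 3: "card ?S2 * p \<le> card (?D t)"
    by (rule card_psubgroup_prime_power[OF prime order S2 D[OF t(1)]])
  have "p ^ 2 * p * p * p \<le> card ?S1 * p * p" using 1 by (intro mult_le_mono1)
  also have "\<dots> \<le> card ?S2 * p" using 2 by (intro mult_le_mono1)
  also note 3
  finally have "p ^ 2 * p * p * p \<le> card (?D t)" .
  moreover have "p ^ 2 * p * p * p = p ^ 5" by (simp add: eval_nat_numeral)
  ultimately have "card (carrier G) \<le> card (?D t)"
    using order n by (simp only: order_def)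
  then have "?D t = carrier G"
    by (intro card_seteq[OF finite_carrier]) auto
  then show False using full[OF t] by blast
qed

text \<open>In a noncyclic center of order \<open>p ^ a\<close> all element orders are below
  \<open>p ^ a\<close>, so \<open>a\<close> is at least 2, while \<open>2 * a < n \<le> 5\<close>.
  Only \<open>a = 2\<close>, \<open>n = 5\<close> remains; then the center has exponent
  \<open>p\<close>, and every noncentral \<open>x\<close> has maximal order modulo the
  center.\<close>

lemma center_cyclic:
  assumes "n \<le> 5"
  shows "cyclic_group (G\<lparr>carrier := center G\<rparr>)"
proof (rule ccontr)
  assume nc: "\<not> cyclic_group (G\<lparr>carrier := center G\<rparr>)"
  have p1: "1 < p" using prime by (rule prime_gt_1_nat)
  obtain a where a: "card (center G) = p ^ a"
    using divides_primepow_nat[OF prime] lagrange[OF center_subgroup] order by (metis dvd_triv_right)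
  have ord: "\<exists>i<a. ord z = p ^ i" if z: "z \<in> center G" for z
  proof -
    obtain i where i: "ord z = p ^ i"
      using divides_primepow_nat[OF prime] ord_dvd_group_order[OF center_carrier[OF z]] order by auto
    have "ord z < card (center G)"
      using cyclic_group_center[OF finite_carrier z] nc by (metis linorder_not_le)
    then have "i < a" unfolding i a by (rule power_less_imp_less_exp[OF p1])
    then show ?thesis using i by blast
  qed
  have "a \<noteq> 0" using ord[OF subgroup.one_closed[OF center_subgroup]] by auto
  have "1 < card (center G)" using a one_less_power[OF p1, of a] \<open>a \<noteq> 0\<close> by simp
  then obtain z where z: "z \<in> center G" "z \<noteq> \<one>"
    using card_le_Suc0_iff_eq[OF finite_center] subgroup.one_closed[OF center_subgroup]
    by (metis One_nat_def linorder_not_le)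
  have zc: "z \<in> carrier G" using z by (simp add: center_carrier)
  obtain i where i: "i < a" "ord z = p ^ i" using ord z by blast
  have "i \<noteq> 0" using i z zc ord_eq_1 by (metis power_0)
  moreover have "2 * a < n" using card_center_bound[OF a] .
  ultimately have a2: "a = 2" and n: "n = 5" and i1: "i = 1" using i(1) assms by auto
  have Zp: "c [^] p = \<one>" if c: "c \<in> center G" for c
  proof -
    obtain j where j: "j < 2" "ord c = p ^ j" using ord[OF c] a2 by blast
    have "ord c dvd p ^ 1" unfolding j(2) using j(1) by (intro le_imp_power_dvd) simp
    then show ?thesis using c by (simp add: pow_eq_id center_carrier)
  qed
  \<comment> \<open>By bilinearity \<open>[g^p,h] = [g,h]^p\<close>, and the center has exponent
    \<open>p\<close>.\<close>
  have powp: "g [^] p \<in> center G" if g: "g \<in> carrier G" for g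
    by (rule centerI) (use g Zp commutator_central in \<open>auto simp: commutator_pow_left\<close>)
  have onto: "commutator G x ` carrier G = center G" if x: "x \<in> carrier G" "x \<notin> center G" for x
  proof (rule commutators_eq_center)
    obtain e where e: "e \<le> n" "\<And>j::int. x [^] j \<in> center G \<longleftrightarrow> int (p ^ e) dvd j"
      by (rule prime_power_exponent[OF prime order center_subgroup x(1)]) (rule that; blast)
    have "x [^] int p \<in> center G" using powp[OF x(1)] by (simp only: int_pow_int)
    then have "p ^ e dvd p ^ 1" using e(2) by (simp only: of_nat_dvd_iff power_one_right)
    then have "e \<le> 1" using p1 by (intro power_dvd_imp_le) auto
    moreover have "e \<noteq> 0"
    proof
      assume "e = 0"
      then have "x [^] (1::int) \<in> center G" using e(2)[of 1] by simp
      then show False using x by simp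
    qed
    ultimately have "e = 1" by simp
    then show "x [^] j \<in> center G \<longleftrightarrow> int p dvd j" for j :: int using e(2)[of j] by simp
  qed (use p1 powp x in auto)
  have N: "subgroup (generate G {z}) G" "generate G {z} \<subseteq> center G" "card (generate G {z}) = p"
    using zc z i i1 generate_subgroup_incl[OF _ center_subgroup, of "{z}"] generate_pow_card[OF zc]
    by (auto intro: generate_is_subgroup)
  show False
    using commutators_not_onto_center_order_p5[OF _ n onto N] a a2 by simp
qed

end

section \<open>Inner automorphisms and the equivalence\<close>

context group
begin

lemma conjugation_auto:
  assumes g: "g \<in> carrier G"
  shows "(\<lambda>x\<in>carrier G. inv g \<otimes> x \<otimes> g) \<in> auto G"
proof -
  let ?c = "\<lambda>x\<in>carrier G. inv g \<otimes> x \<otimes> g"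
  have "?c \<in> hom G G"
  proof (rule homI)
    fix x y assume xy: "x \<in> carrier G" "y \<in> carrier G"
    have "(inv g \<otimes> x \<otimes> g) \<otimes> (inv g \<otimes> y \<otimes> g) = inv g \<otimes> x \<otimes> ((g \<otimes> inv g) \<otimes> y) \<otimes> g"
      using xy g by (simp only: m_assoc m_closed inv_closed)
    then show "?c (x \<otimes> y) = ?c x \<otimes> ?c y"
      using xy g by (simp add: m_assoc)
  qed (use g in auto)
  moreover have "bij_betw ?c (carrier G) (carrier G)"
  proof (rule bij_betw_byWitness[where f' = "\<lambda>x. g \<otimes> x \<otimes> inv g"])
    have "g \<otimes> (inv g \<otimes> x \<otimes> g) \<otimes> inv g = (g \<otimes> inv g) \<otimes> x \<otimes> (g \<otimes> inv g)" if "x \<in> carrier G" for x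
      using that g by (simp only: m_assoc m_closed inv_closed)
    then show "\<forall>x\<in>carrier G. g \<otimes> ?c x \<otimes> inv g = x" using g by simp
    have "inv g \<otimes> (g \<otimes> x \<otimes> inv g) \<otimes> g = (inv g \<otimes> g) \<otimes> x \<otimes> (inv g \<otimes> g)" if "x \<in> carrier G" for x
      using that g by (simp only: m_assoc m_closed inv_closed)
    then show "\<forall>x\<in>carrier G. ?c (g \<otimes> x \<otimes> inv g) = x" using g by simp
  qed (use g in auto)
  ultimately show ?thesis by (simp add: auto_def Bij_def)
qed

text \<open>Conjugation by \<open>g\<close> is class preserving, hence central, and it moves
  \<open>x\<close> by exactly \<open>commutator G x g\<close>.\<close>

lemma class_two_if_class_preserving_central:
  assumes "class_preserving_auto G \<subseteq> central_auto G"
  shows "class_two_group G"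
proof
  fix x g assume xg: "x \<in> carrier G" "g \<in> carrier G"
  let ?c = "\<lambda>x\<in>carrier G. inv g \<otimes> x \<otimes> g"
  have "?c \<in> class_preserving_auto G"
    unfolding class_preserving_auto_def using conjugation_auto[OF xg(2)] xg(2) by auto
  then have "inv x \<otimes> ?c x \<in> center G"
    using assms xg(1) unfolding central_auto_def by blast
  then show "commutator G x g \<in> center G"
    using xg by (simp add: commutator_def)
qed

end

theorem theorem4p3:
  fixes G (structure) and p n :: nat
  assumes "group G"
    and "\<not> comm_group G"
    and "Factorial_Ring.prime p"
    and "order G = p ^ n"
    and "3 \<le> n" and "n \<le> 5"
  shows "class_preserving_auto G = central_auto G \<longleftrightarrow>
    derived G (carrier G) = center G \<and> cyclic_group (G\<lparr>carrier := center G\<rparr>)"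
proof -
  interpret group G by fact
  have fin: "finite (carrier G)"
    using assms(3,4) order_gt_0_iff_finite by (simp add: prime_gt_0_nat)
  have nonabelian: "center G \<noteq> carrier G"
    using assms(2) center_comm by (metis group_comm_groupI)
  show ?thesis
  proof
    assume eq: "class_preserving_auto G = central_auto G"
    interpret class_two_group G
      by (rule class_two_if_class_preserving_central) (simp add: eq)
    interpret central_class_preserving_p_group G p n
      using assms(3,4) nonabelian eq by unfold_locales auto
    show "derived G (carrier G) = center G \<and> cyclic_group (G\<lparr>carrier := center G\<rparr>)"
      using derived_eq_center center_cyclic[OF assms(6)] by blast
  next
    assume r: "derived G (carrier G) = center G \<and> cyclic_group (G\<lparr>carrier := center G\<rparr>)"
    interpret class_two_group G
      by unfold_locales (use commutator_in_derived r in blast)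
    show "class_preserving_auto G = central_auto G"
      using class_preserving_subset_central central_subset_class_preserving[OF fin] r by blast
  qed
qed

end
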